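(* Let $f^{(n)}(x)$ be the $f$-vector of $CRY_n=\mathrm{Flow}_n(1,0,\dots,0)$ written as a Laurent polynomial. Then for all $n\ge1$: $$f^{(n)}(x)=\frac1x+\frac1{x^n}\sum_{m=0}^{n-2}(-1)^m(1+x)^m\,\pi_{n-m}(x)\cdot h_m\big(x,\ (x+1)^2-1,\ \dots,\ (x+1)^{n-m-1}-1\big).$$
   Context: $K_{n+1}$ is the directed graph on $v_1,\dots,v_{n+1}$ with one edge $(v_i,v_j)$ for each $1\le i<j\le n+1$. $CRY_n$ (the Chan–Robbins–Yuen polytope) is the flow polytope $\mathrm{Flow}_n(1,0,\dots,0)\subset\mathbb R^{E(K_{n+1})}$ consisting of all functions $f:E(K_{n+1})\to\mathbb R_{\ge0}$ such that $\sum_{j>i}f(v_i,v_j)-\sum_{k<i}f(v_k,v_i)$ equals $1$ for $i=1$ and $0$ for $2\le i\le n$. Its $f$-vector written as a Laurent polynomial is $f^{(n)}(x)=\sum_{d\ge-1}f_d\,x^d$, where $f_d$ is the number of $d$-dimensional faces (the empty face counts as a face of dimension $-1$, and the polytope itself counts as a face). $\pi_k(x)=\prod_{i=1}^k\big((x+1)^i-1\big)$, and $h_m$ is the complete homogeneous symmetric polynomial of degree $m$ in the listed variables, which are $(x+1)^i-1$ for $1\le i\le n-m-1$ (the first being $(x+1)^1-1=x$); $h_0=1$.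
   Formalization: For n = 1 the printed sum from m = 0 to -1 is empty and gives 1/x, but CRY_1 is a point with f-vector 1/x + 1; the formal statement keeps the m = 0 term at n = 1, which gives the correct value. For n ≥ 2 the formula is as printed. *)

theory Defs
  imports "HOL-Analysis.Analysis" "HOL-Computational_Algebra.Formal_Laurent_Series"
begin

definition complete_edges :: "nat \<Rightarrow> (nat \<times> nat) set" where
  "complete_edges n = {(i, j). 1 \<le> i \<and> i < j \<and> j \<le> n + 1}"

(* The ambient space must be a euclidean_space type for face_of and aff_dim. It is
   real ^ 'e, where the finite type 'e is a copy of the edge set of K_{n+1}: ends maps
   each edge to its (tail, head), and is meant to satisfy
   bij_betw ends UNIV (complete_edges n). Such a type exists for every n >= 1. There is
   no flow condition at the sink n + 1. *)
definition flow_polytope ::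
    "('e::finite \<Rightarrow> nat \<times> nat) \<Rightarrow> nat \<Rightarrow> (nat \<Rightarrow> real) \<Rightarrow> (real ^ 'e) set" where
  "flow_polytope ends n a =
     {f. (\<forall>e. 0 \<le> f $ e) \<and>
         (\<forall>i\<in>{1..n}. (\<Sum>e | fst (ends e) = i. f $ e) - (\<Sum>e | snd (ends e) = i. f $ e) = a i)}"

definition CRY :: "('e::finite \<Rightarrow> nat \<times> nat) \<Rightarrow> nat \<Rightarrow> (real ^ 'e) set" where
  "CRY ends n = flow_polytope ends n (\<lambda>i. if i = 1 then 1 else 0)"

(* In the library {} and P are faces of a convex P, and aff_dim {} = - 1. *)
definition face_count :: "'a::euclidean_space set \<Rightarrow> int \<Rightarrow> nat" where
  "face_count P d = card {F. F face_of P \<and> aff_dim F = d}"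

definition f_vector :: "'a::euclidean_space set \<Rightarrow> rat fls" where
  "f_vector P = (\<Sum>d = -1..aff_dim P. of_nat (face_count P d) * fls_X powi d)"

definition q_factor :: "nat \<Rightarrow> rat fls" where
  "q_factor i = (fls_X + 1) ^ i - 1"

definition pi_poly :: "nat \<Rightarrow> rat fls" where
  "pi_poly k = (\<Prod>i = 1..k. q_factor i)"

(* The monomials of degree m in the variables y i (i in I) correspond to the multisets of
   size m on I; in particular degree 0 gives 1, also when I is empty. *)
definition complete_homogeneous :: "nat \<Rightarrow> 'i set \<Rightarrow> ('i \<Rightarrow> 'a::comm_semiring_1) \<Rightarrow> 'a" where
  "complete_homogeneous m I y =
     (\<Sum>M | set_mset M \<subseteq> I \<and> size M = m. \<Prod>i\<in>#M. y i)"

(* The formula for the f-vector sums over m = 0..n-2. For n = 1 an empty sum would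
   give 1/x, but CRY_1 is a point with f-vector 1/x + 1. Subtraction on nat makes the range
   {0..0} for n = 1, and its single term pi_1 * h_0 = x gives the correct value. For
   n >= 2 no subtraction in the formula truncates. *)
end

theory Submission
  imports Defs
begin

text \<open>
  A nonempty face of the nonnegative part of an affine space is determined by the largest support of
  its points. For the polytope of unit flows these supports are the edge sets \<open>E\<close> in which
  vertex \<open>1\<close> has an outgoing edge and every other vertex up to \<open>n\<close> has an outgoing
  edge iff it has an incoming one; the dimension of the face is the number of edges minus the number
  of tails, because the conservation laws at the tails are independent on \<open>E\<close>.

  To count these edge sets, remove the vertices \<open>n, n - 1, \<dots>, 1\<close> one after the other and
  enforce by inclusion-exclusion that each of them with an outgoing edge receives an edge. Only
  the number \<open>k\<close> of removed vertices that may still receive edges matters. With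
  \<open>q\<^sub>k = (x + 1)\<^sup>k - 1\<close> a step keeps \<open>k\<close> with weight \<open>x - q\<^sub>k\<close>
  or raises it by one with weight \<open>q\<^sub>k\<close>, which yields products of consecutive
  \<open>q\<^sub>i\<close> times complete homogeneous polynomials in the \<open>x - q\<^sub>i\<close>. Finally
  \<open>x - q\<^sub>1 = 0\<close>, and \<open>x - (x + 1)\<^sup>i\<^sup>+\<^sup>1 + 1 = - (1 + x) q\<^sub>i\<close>
  lowers all remaining indices by one.
\<close>

subsection \<open>Counting edge sets by inclusion-exclusion\<close>

lemma sum_Pow_power_card:
  fixes x :: "'a::comm_ring_1"
  assumes "finite U"
  shows "(\<Sum>A\<in>Pow U. x ^ card A) = (x + 1) ^ card U"
  using prod_add[OF assms, of "\<lambda>_. x" "\<lambda>_. 1"] by simp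

lemma sum_nonempty_subsets_power_card:
  fixes x :: "'a::comm_ring_1"
  assumes "finite U"
  shows "(\<Sum>A\<in>Pow U - {{}}. x ^ card A) = (x + 1) ^ card U - 1"
  using sum_Pow_power_card[OF assms, of x] assms
  by (simp add: sum.remove[of "Pow U" "{}"] algebra_simps)

lemma sum_Pow_sign:
  assumes "finite B"
  shows "(\<Sum>Z\<in>Pow B. (- 1 :: 'a::comm_ring_1) ^ card Z) = of_bool (B = {})"
  using sum_Pow_power_card[OF assms, of "- 1 :: 'a"] assms by (simp add: power_0_left)

text \<open>Here \<open>U\<close> holds the vertices above \<open>v\<close> that may receive edges and
  \<open>D\<close> those that must.\<close>

definition covering_graphs :: "nat \<Rightarrow> nat set \<Rightarrow> nat set \<Rightarrow> (nat \<times> nat) set set" where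
  "covering_graphs v U D =
     {E. (\<forall>(i, j)\<in>E. 1 \<le> i \<and> i \<le> v \<and> i < j \<and> (j \<le> v \<or> j \<in> U)) \<and> 1 \<in> fst ` E \<and>
         (\<forall>i\<in>{2..v}. i \<in> fst ` E \<longleftrightarrow> i \<in> snd ` E) \<and> D \<subseteq> snd ` E}"

text \<open>Every edge contributes a factor \<open>x\<close>, and so does every vertex up to
  \<open>v\<close> without outgoing edge. For the edge set of a support and \<open>v = n\<close> the
  exponent is therefore the dimension of the face plus \<open>n\<close>.\<close>

definition covering_weight :: "nat \<Rightarrow> 'a::comm_ring_1 \<Rightarrow> (nat \<times> nat) set \<Rightarrow> 'a" where
  "covering_weight v x E = x ^ (card E + (v - card (fst ` E)))"

text \<open>\<open>transfer_coeff x v\<close> belongs to \<open>v + 1\<close> remaining vertices.\<close>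

fun transfer_coeff :: "'a::comm_ring_1 \<Rightarrow> nat \<Rightarrow> nat \<Rightarrow> 'a" where
  "transfer_coeff x 0 k = (x + 1) ^ k - 1"
| "transfer_coeff x (Suc v) k = x * transfer_coeff x v k +
     ((x + 1) ^ k - 1) * (transfer_coeff x v (Suc k) - transfer_coeff x v k)"

section \<open>Removing the top vertex of a covering graph\<close>

lemma covering_graphs_tails:
  assumes "E \<in> covering_graphs v U D"
  shows "fst ` E \<subseteq> {1..v}"
  using assms unfolding covering_graphs_def by fastforce

lemma covering_graphs_subset:
  "covering_graphs v U D \<subseteq> Pow ({1..v} \<times> ({1..v} \<union> U))"
  unfolding covering_graphs_def by fastforce

lemma finite_covering_graphs: "finite U \<Longrightarrow> finite (covering_graphs v U D)"
  by (rule finite_subset[OF covering_graphs_subset]) auto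

lemma covering_graphs_finite_mem: "finite U \<Longrightarrow> E \<in> covering_graphs v U D \<Longrightarrow> finite E"
  by (rule finite_subset[of _ "{1..v} \<times> ({1..v} \<union> U)"]) (use covering_graphs_subset[of v U D] in blast, simp)

text \<open>If \<open>Suc v\<close> has no outgoing edge, the balance condition at this vertex,
  which is at least 2, forbids incoming ones too. Conversely, \<open>U\<close> lies above
  \<open>Suc v\<close>, so a graph for \<open>v\<close> never touches it.\<close>

lemma covering_graphs_without_top:
  assumes "1 \<le> v" "U \<subseteq> {Suc v<..}" "D \<subseteq> U"
  shows "{E \<in> covering_graphs (Suc v) U D. Suc v \<notin> fst ` E} = covering_graphs v U D"
proof (intro equalityI subsetI)
  fix E assume "E \<in> {E \<in> covering_graphs (Suc v) U D. Suc v \<notin> fst ` E}"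
  then have E: "E \<in> covering_graphs (Suc v) U D" and t: "Suc v \<notin> fst ` E" by auto
  then have h: "Suc v \<notin> snd ` E" using assms(1) unfolding covering_graphs_def by auto
  have "1 \<le> i \<and> i \<le> v \<and> i < j \<and> (j \<le> v \<or> j \<in> U)" if "(i, j) \<in> E" for i j
  proof -
    have "1 \<le> i \<and> i \<le> Suc v \<and> i < j \<and> (j \<le> Suc v \<or> j \<in> U)"
      using E that unfolding covering_graphs_def by auto
    moreover have "i \<noteq> Suc v" "j \<noteq> Suc v" using that t h by force+
    ultimately show ?thesis by auto
  qed
  then show "E \<in> covering_graphs v U D"
    using E unfolding covering_graphs_def by auto
next
  fix E assume E: "E \<in> covering_graphs v U D"
  then have e: "1 \<le> i \<and> i \<le> v \<and> i < j \<and> (j \<le> v \<or> j \<in> U)" if "(i, j) \<in> E" for i j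
    using that unfolding covering_graphs_def by auto
  have t: "Suc v \<notin> fst ` E" using e by fastforce
  have h: "Suc v \<notin> snd ` E" using e assms(2) by fastforce
  have "i \<in> fst ` E \<longleftrightarrow> i \<in> snd ` E" if "i \<in> {2..Suc v}" for i
    using that E t h unfolding covering_graphs_def by (cases "i = Suc v") auto
  moreover have "1 \<le> i \<and> i \<le> Suc v \<and> i < j \<and> (j \<le> Suc v \<or> j \<in> U)" if "(i, j) \<in> E" for i j
    using e[OF that] by auto
  moreover have "1 \<in> fst ` E" "D \<subseteq> snd ` E" using E unfolding covering_graphs_def by auto
  ultimately have "E \<in> covering_graphs (Suc v) U D" unfolding covering_graphs_def by blast
  then show "E \<in> {E \<in> covering_graphs (Suc v) U D. Suc v \<notin> fst ` E}"
    using t by blast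
qed

text \<open>\<open>A\<close> becomes the out-neighbourhood of the new tail \<open>Suc v\<close>. As
  a tail, \<open>Suc v\<close> must receive an edge from below and joins the required set, while the
  vertices of \<open>A\<close> are already served.\<close>

lemma covering_graphs_extend:
  assumes "1 \<le> v" "U \<subseteq> {Suc v<..}" "D \<subseteq> U" "A \<subseteq> U" "A \<noteq> {}"
    and E: "E \<in> covering_graphs v (insert (Suc v) U) (insert (Suc v) (D - A))"
  shows "{Suc v} \<times> A \<union> E \<in> covering_graphs (Suc v) U D"
proof -
  let ?E = "{Suc v} \<times> A \<union> E"
  have e: "1 \<le> i \<and> i \<le> v \<and> i < j \<and> (j \<le> v \<or> j = Suc v \<or> j \<in> U)" if "(i, j) \<in> E" for i j
    using that E unfolding covering_graphs_def by auto
  have f: "fst ` ?E = insert (Suc v) (fst ` E)" and s: "snd ` ?E = A \<union> snd ` E"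
    using assms(5) by (auto simp: image_Un)
  have "1 \<in> fst ` E" "insert (Suc v) (D - A) \<subseteq> snd ` E"
    and "\<forall>i\<in>{2..v}. i \<in> fst ` E \<longleftrightarrow> i \<in> snd ` E"
    using E unfolding covering_graphs_def by auto
  moreover have "i \<notin> A" if "i \<le> v" for i using that assms(2,4) by auto
  ultimately have "i \<in> fst ` ?E \<longleftrightarrow> i \<in> snd ` ?E" if "i \<in> {2..Suc v}" for i
    unfolding f s using that by (cases "i = Suc v") simp_all
  moreover have "D \<subseteq> snd ` ?E" "1 \<in> fst ` ?E"
    unfolding f s using \<open>insert (Suc v) (D - A) \<subseteq> snd ` E\<close> \<open>1 \<in> fst ` E\<close> by auto
  moreover have "1 \<le> i \<and> i \<le> Suc v \<and> i < j \<and> (j \<le> Suc v \<or> j \<in> U)" if "(i, j) \<in> ?E" for i j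
    using that e[of i j] assms(1,2,4) by auto
  ultimately show ?thesis unfolding covering_graphs_def by blast
qed

text \<open>Edges go upwards, so those out of \<open>Suc v\<close> serve no vertex up to
  \<open>Suc v\<close>, and the conditions at these vertices survive the removal. This is the
  inverse of \<open>covering_graphs_extend\<close>.\<close>

lemma covering_graphs_remove_top:
  assumes "1 \<le> v" "U \<subseteq> {Suc v<..}"
    and E: "E \<in> covering_graphs (Suc v) U D" and t: "Suc v \<in> fst ` E"
  shows "E `` {Suc v} \<in> Pow U - {{}}"
    and "{e \<in> E. fst e \<noteq> Suc v} \<in> covering_graphs v (insert (Suc v) U) (insert (Suc v) (D - E `` {Suc v}))"
    and "{Suc v} \<times> E `` {Suc v} \<union> {e \<in> E. fst e \<noteq> Suc v} = E"
proof -
  have e: "1 \<le> i \<and> i \<le> Suc v \<and> i < j \<and> (j \<le> Suc v \<or> j \<in> U)" if "(i, j) \<in> E" for i j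
    using that E unfolding covering_graphs_def by auto
  show A: "E `` {Suc v} \<in> Pow U - {{}}" using e t by fastforce
  show "{Suc v} \<times> E `` {Suc v} \<union> {e \<in> E. fst e \<noteq> Suc v} = E" by auto
  let ?E = "{e \<in> E. fst e \<noteq> Suc v}"
  have f: "fst ` ?E = fst ` E - {Suc v}" by auto
  have s: "snd ` E = E `` {Suc v} \<union> snd ` ?E" by force
  have E': "1 \<in> fst ` E" "D \<subseteq> snd ` E" "\<forall>i\<in>{2..Suc v}. i \<in> fst ` E \<longleftrightarrow> i \<in> snd ` E"
    using E unfolding covering_graphs_def by auto
  have n: "i \<notin> E `` {Suc v}" if "i \<le> Suc v" for i using that e[of "Suc v" i] by auto
  have "Suc v \<in> snd ` ?E" using E'(3) t n[of "Suc v"] assms(1) s by auto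
  then have "insert (Suc v) (D - E `` {Suc v}) \<subseteq> snd ` ?E" using E'(2) s by auto
  moreover have "1 \<in> fst ` ?E" using E'(1) assms(1) unfolding f by auto
  moreover have "\<forall>i\<in>{2..v}. i \<in> fst ` ?E \<longleftrightarrow> i \<in> snd ` ?E"
    using E'(3) n s unfolding f by auto
  moreover have "1 \<le> i \<and> i \<le> v \<and> i < j \<and> (j \<le> v \<or> j \<in> insert (Suc v) U)" if "(i, j) \<in> ?E" for i j
    using that e[of i j] by auto
  ultimately show "?E \<in> covering_graphs v (insert (Suc v) U) (insert (Suc v) (D - E `` {Suc v}))"
    unfolding covering_graphs_def by blast
qed

text \<open>The cases are whether \<open>Suc v\<close> is a tail. If not, it is one more vertex
  without outgoing edge, hence the factor \<open>x\<close>. If it is, its edges give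
  \<open>x ^ card A\<close>, and the additional tail offsets the larger \<open>v\<close>.\<close>

lemma sum_covering_graphs_Suc:
  fixes x :: "'a::comm_ring_1"
  assumes v: "1 \<le> v" and U: "U \<subseteq> {Suc v<..}" "finite U" and D: "D \<subseteq> U"
  shows "(\<Sum>E\<in>covering_graphs (Suc v) U D. covering_weight (Suc v) x E) =
     x * (\<Sum>E\<in>covering_graphs v U D. covering_weight v x E) +
     (\<Sum>A\<in>Pow U - {{}}. x ^ card A *
        (\<Sum>E\<in>covering_graphs v (insert (Suc v) U) (insert (Suc v) (D - A)). covering_weight v x E))"
proof -
  let ?G = "covering_graphs (Suc v) U D" and ?w = "covering_weight (Suc v) x"
  let ?H = "\<lambda>A. covering_graphs v (insert (Suc v) U) (insert (Suc v) (D - A))"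
  have card_tails: "card (fst ` E) \<le> v" if "E \<in> covering_graphs v U' D'" for E U' D'
    using card_mono[OF _ covering_graphs_tails[OF that]] by simp
  have split: "{E\<in>?G. Suc v \<notin> fst ` E} \<union> {E\<in>?G. Suc v \<in> fst ` E} = ?G"
    and disjoint: "{E\<in>?G. Suc v \<notin> fst ` E} \<inter> {E\<in>?G. Suc v \<in> fst ` E} = {}" by blast+
  have "(\<Sum>E\<in>?G. ?w E) = (\<Sum>E\<in>{E\<in>?G. Suc v \<notin> fst ` E}. ?w E) + (\<Sum>E\<in>{E\<in>?G. Suc v \<in> fst ` E}. ?w E)"
    using sum.union_disjoint[of "{E\<in>?G. Suc v \<notin> fst ` E}" "{E\<in>?G. Suc v \<in> fst ` E}" ?w]
      finite_covering_graphs[OF U(2)] by (simp add: split disjoint)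
  also have "(\<Sum>E\<in>{E\<in>?G. Suc v \<notin> fst ` E}. ?w E) = x * (\<Sum>E\<in>covering_graphs v U D. covering_weight v x E)"
    unfolding covering_graphs_without_top[OF v U(1) D] sum_distrib_left
    by (rule sum.cong) (simp_all add: covering_weight_def Suc_diff_le[OF card_tails])
  also have "(\<Sum>E\<in>{E\<in>?G. Suc v \<in> fst ` E}. ?w E) =
      (\<Sum>(A, E)\<in>Sigma (Pow U - {{}}) ?H. x ^ card A * covering_weight v x E)"
  proof (rule sum.reindex_bij_witness[where i = "\<lambda>(A, E). {Suc v} \<times> A \<union> E"
        and j = "\<lambda>E. (E `` {Suc v}, {e \<in> E. fst e \<noteq> Suc v})"])
    fix E assume "E \<in> {E\<in>?G. Suc v \<in> fst ` E}"
    then have E: "E \<in> ?G" and t: "Suc v \<in> fst ` E" by auto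
    note r = covering_graphs_remove_top[OF v U(1) E t]
    let ?A = "E `` {Suc v}" and ?E = "{e \<in> E. fst e \<noteq> Suc v}"
    show "(case (?A, ?E) of (A, E) \<Rightarrow> {Suc v} \<times> A \<union> E) = E" using r(3) by simp
    show "(?A, ?E) \<in> Sigma (Pow U - {{}}) ?H" using r(1,2) by auto
    have fin: "finite E" using covering_graphs_finite_mem[OF U(2) E] .
    have "finite ?A" using r(1) U(2) finite_subset by auto
    then have "card ({Suc v} \<times> ?A \<union> ?E) = card ({Suc v} \<times> ?A) + card ?E"
      using fin by (intro card_Un_disjoint) auto
    then have c: "card E = card ?A + card ?E"
      unfolding r(3) card_cartesian_product_singleton .
    have "fst ` E = insert (Suc v) (fst ` ?E)" "Suc v \<notin> fst ` ?E" using t by auto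
    then have "card (fst ` E) = Suc (card (fst ` ?E))"
      using fin by simp
    then show "(case (?A, ?E) of (A, E) \<Rightarrow> x ^ card A * covering_weight v x E) = ?w E"
      by (simp add: covering_weight_def c power_add)
  next
    fix p assume "p \<in> Sigma (Pow U - {{}}) ?H"
    then obtain A E where p: "p = (A, E)" and A: "A \<subseteq> U" "A \<noteq> {}" and E: "E \<in> ?H A" by auto
    have "Suc v \<notin> fst ` E" using covering_graphs_tails[OF E] by auto
    then have n: "(Suc v, j) \<notin> E" for j by force
    show "(case p of (A, E) \<Rightarrow> {Suc v} \<times> A \<union> E) \<in> {E\<in>?G. Suc v \<in> fst ` E}"
      using covering_graphs_extend[OF v U(1) D A E] A(2) by (simp add: p image_Un)
    show "((case p of (A, E) \<Rightarrow> {Suc v} \<times> A \<union> E) `` {Suc v},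
        {e \<in> (case p of (A, E) \<Rightarrow> {Suc v} \<times> A \<union> E). fst e \<noteq> Suc v}) = p"
      unfolding p using n by auto
  qed
  also have "\<dots> = (\<Sum>A\<in>Pow U - {{}}. x ^ card A * (\<Sum>E\<in>?H A. covering_weight v x E))"
    using U(2) by (simp add: sum.Sigma[symmetric] finite_covering_graphs sum_distrib_left)
  finally show ?thesis .
qed

text \<open>Inclusion-exclusion over the vertices of \<open>D\<close> that receive no edge.\<close>

lemma sum_covering_subsets_exchange:
  fixes x :: "'a::comm_ring_1" and g :: "nat \<Rightarrow> 'a"
  assumes U: "finite U" and D: "D \<subseteq> U"
  shows "(\<Sum>A\<in>Pow U - {{}}. x ^ card A * (\<Sum>Z\<in>Pow (D - A). (- 1) ^ card Z * g (card Z))) =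
     (\<Sum>Z\<in>Pow D. (- 1) ^ card Z * (((x + 1) ^ (card U - card Z) - 1) * g (card Z)))"
proof -
  have fD: "finite D" using U D finite_subset by auto
  have "(\<Sum>A\<in>Pow U - {{}}. x ^ card A * (\<Sum>Z\<in>Pow (D - A). (- 1) ^ card Z * g (card Z)))
      = (\<Sum>A\<in>Pow U - {{}}. \<Sum>Z\<in>{Z\<in>Pow D. Z \<inter> A = {}}. x ^ card A * ((- 1) ^ card Z * g (card Z)))"
    unfolding sum_distrib_left by (intro sum.cong) auto
  also have "\<dots> = (\<Sum>Z\<in>Pow D. \<Sum>A\<in>{A\<in>Pow U - {{}}. Z \<inter> A = {}}. x ^ card A * ((- 1) ^ card Z * g (card Z)))"
    by (rule sum.swap_restrict) (use U fD in auto)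
  also have "\<dots> = (\<Sum>Z\<in>Pow D. (- 1) ^ card Z * (((x + 1) ^ (card U - card Z) - 1) * g (card Z)))"
  proof (rule sum.cong)
    fix Z assume Z: "Z \<in> Pow D"
    then have fZ: "finite Z" using fD finite_subset by auto
    \<comment> \<open>The sets \<open>A\<close> avoiding \<open>Z\<close> are the nonempty subsets
      of \<open>U - Z\<close>, so the inner sum depends on \<open>Z\<close> only through its
      cardinality.\<close>
    have "{A\<in>Pow U - {{}}. Z \<inter> A = {}} = Pow (U - Z) - {{}}" by auto
    moreover have "card (U - Z) = card U - card Z" using Z D fZ by (intro card_Diff_subset) auto
    ultimately show "(\<Sum>A\<in>{A\<in>Pow U - {{}}. Z \<inter> A = {}}. x ^ card A * ((- 1) ^ card Z * g (card Z)))
        = (- 1) ^ card Z * (((x + 1) ^ (card U - card Z) - 1) * g (card Z))"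
      using sum_nonempty_subsets_power_card[of "U - Z" x] U
      by (simp only: sum_distrib_right[symmetric] finite_Diff mult.left_commute)
  qed simp
  finally show ?thesis .
qed

text \<open>Vertex 1 is the only tail, so a graph amounts to its out-neighbourhood \<open>A\<close>,
  a nonempty subset of \<open>U\<close> containing \<open>D\<close>, with weight
  \<open>x ^ card A\<close>.\<close>

lemma sum_covering_graphs_base:
  fixes x :: "'a::comm_ring_1"
  assumes U: "U \<subseteq> {1<..}" "finite U" and D: "D \<subseteq> U"
  shows "(\<Sum>E\<in>covering_graphs 1 U D. covering_weight 1 x E) =
     (\<Sum>Z\<in>Pow D. (- 1) ^ card Z * ((x + 1) ^ (card U - card Z) - 1))"
proof -
  have fD: "finite D" using U D finite_subset by auto
  have "(\<Sum>E\<in>covering_graphs 1 U D. covering_weight 1 x E) = (\<Sum>A\<in>{A\<in>Pow U - {{}}. D \<subseteq> A}. x ^ card A)"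
  proof (rule sum.reindex_bij_witness[where i = "\<lambda>A. {1} \<times> A" and j = "\<lambda>E. snd ` E"])
    fix E assume E: "E \<in> covering_graphs 1 U D"
    then have e: "i = 1 \<and> j \<in> U" if "(i, j) \<in> E" for i j
      using that unfolding covering_graphs_def by fastforce
    have ne: "E \<noteq> {}" and "D \<subseteq> snd ` E" using E unfolding covering_graphs_def by auto
    show EE: "{1} \<times> snd ` E = E" using e by force
    show "snd ` E \<in> {A\<in>Pow U - {{}}. D \<subseteq> A}" using e ne \<open>D \<subseteq> snd ` E\<close> by auto
    have "card E = card (snd ` E)"
      by (subst EE[symmetric]) (simp add: card_cartesian_product_singleton)
    moreover have "fst ` E = {1}" using e ne by force
    ultimately show "x ^ card (snd ` E) = covering_weight 1 x E" by (simp add: covering_weight_def)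
  next
    fix A assume "A \<in> {A\<in>Pow U - {{}}. D \<subseteq> A}"
    then show "{1} \<times> A \<in> covering_graphs 1 U D" "snd ` ({1::nat} \<times> A) = A"
      using U(1) unfolding covering_graphs_def by auto
  qed
  also have "\<dots> = (\<Sum>A\<in>Pow U - {{}}. x ^ card A * of_bool (D - A = {}))"
    by (rule sum.mono_neutral_cong_left) (use U in auto)
  \<comment> \<open>The indicator becomes an alternating sum, which has the form of
    \<open>sum_covering_subsets_exchange\<close> with \<open>g\<close> constantly 1.\<close>
  also have "\<dots> = (\<Sum>A\<in>Pow U - {{}}. x ^ card A * (\<Sum>Z\<in>Pow (D - A). (- 1) ^ card Z * 1))"
    using fD by (intro sum.cong) (auto simp: sum_Pow_sign simp del: Diff_eq_empty_iff)
  also have "\<dots> = (\<Sum>Z\<in>Pow D. (- 1) ^ card Z * ((x + 1) ^ (card U - card Z) - 1))"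
    using sum_covering_subsets_exchange[OF U(2) D, of x "\<lambda>_. 1"] by simp
  finally show ?thesis .
qed

text \<open>Pairing \<open>Z\<close> with \<open>insert u Z\<close> flips the sign and raises the
  cardinality. It is applied to the removed vertex \<open>u\<close>: the difference expresses that
  \<open>u\<close> has to receive an edge.\<close>

lemma sum_Pow_insert_sign:
  fixes g :: "nat \<Rightarrow> 'a::comm_ring_1"
  assumes "finite B" "u \<notin> B"
  shows "(\<Sum>Z\<in>Pow (insert u B). (- 1) ^ card Z * g (card Z)) =
     (\<Sum>Z\<in>Pow B. (- 1) ^ card Z * (g (card Z) - g (Suc (card Z))))"
proof -
  have "(\<Sum>Z\<in>Pow (insert u B). (- 1) ^ card Z * g (card Z))
      = (\<Sum>Z\<in>Pow B. (- 1) ^ card Z * g (card Z)) + (\<Sum>Z\<in>insert u ` Pow B. (- 1) ^ card Z * g (card Z))"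
    unfolding Pow_insert using assms by (intro sum.union_disjoint) auto
  also have "(\<Sum>Z\<in>insert u ` Pow B. (- 1) ^ card Z * g (card Z))
      = (\<Sum>Z\<in>Pow B. (- 1) ^ card (insert u Z) * g (card (insert u Z)))"
    using assms by (subst sum.reindex) (auto simp: inj_on_def)
  also have "\<dots> = (\<Sum>Z\<in>Pow B. - ((- 1) ^ card Z * g (Suc (card Z))))"
  proof (rule sum.cong)
    fix Z assume "Z \<in> Pow B"
    then have "finite Z" "u \<notin> Z" using assms finite_subset by auto
    then show "(- 1) ^ card (insert u Z) * g (card (insert u Z)) = - ((- 1) ^ card Z * g (Suc (card Z)))"
      by simp
  qed simp
  finally show ?thesis by (simp add: sum_negf sum_subtractf right_diff_distrib)
qed

text \<open>\<open>Z\<close> consists of required vertices that are forbidden as heads, which leaves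
  \<open>card U - card Z\<close> possible heads and no requirement. \<open>U\<close> and
  \<open>D\<close> vary in the induction because each removed tail joins both.\<close>

lemma sum_covering_graphs:
  fixes x :: "'a::comm_ring_1"
  assumes "U \<subseteq> {Suc v<..}" "finite U" "D \<subseteq> U"
  shows "(\<Sum>E\<in>covering_graphs (Suc v) U D. covering_weight (Suc v) x E) =
     (\<Sum>Z\<in>Pow D. (- 1) ^ card Z * transfer_coeff x v (card U - card Z))"
  using assms
proof (induction v arbitrary: U D)
  case 0
  then show ?case using sum_covering_graphs_base[of U D x] by simp
next
  case (Suc v)
  let ?u = "Suc (Suc v)" and ?c = "transfer_coeff x v"
  have fD: "finite D" using Suc.prems finite_subset by auto
  have uU: "?u \<notin> U" "?u \<notin> D" using Suc.prems by auto
  have IH1: "(\<Sum>E\<in>covering_graphs (Suc v) U D. covering_weight (Suc v) x E) =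
     (\<Sum>Z\<in>Pow D. (- 1) ^ card Z * ?c (card U - card Z))"
    using Suc.prems by (intro Suc.IH) auto
  \<comment> \<open>The removed vertex is allowed and required at once, so it contributes the
    coefficient with it as a possible head minus the one without it.\<close>
  have IH2: "(\<Sum>E\<in>covering_graphs (Suc v) (insert ?u U) (insert ?u (D - A)). covering_weight (Suc v) x E) =
     (\<Sum>Z\<in>Pow (D - A). (- 1) ^ card Z * (?c (Suc (card U) - card Z) - ?c (card U - card Z)))" for A
  proof -
    have "(\<Sum>E\<in>covering_graphs (Suc v) (insert ?u U) (insert ?u (D - A)). covering_weight (Suc v) x E) =
      (\<Sum>Z\<in>Pow (insert ?u (D - A)). (- 1) ^ card Z * ?c (card (insert ?u U) - card Z))"
      using Suc.prems by (intro Suc.IH) auto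
    then show ?thesis
      using sum_Pow_insert_sign[of "D - A" ?u "\<lambda>k. ?c (Suc (card U) - k)"] fD uU Suc.prems by simp
  qed
  have "(\<Sum>E\<in>covering_graphs ?u U D. covering_weight ?u x E) =
     x * (\<Sum>Z\<in>Pow D. (- 1) ^ card Z * ?c (card U - card Z)) +
     (\<Sum>A\<in>Pow U - {{}}. x ^ card A *
        (\<Sum>Z\<in>Pow (D - A). (- 1) ^ card Z * (?c (Suc (card U) - card Z) - ?c (card U - card Z))))"
    using Suc.prems by (subst sum_covering_graphs_Suc) (simp_all add: IH1 IH2 del: transfer_coeff.simps)
  also have "\<dots> = x * (\<Sum>Z\<in>Pow D. (- 1) ^ card Z * ?c (card U - card Z)) +
     (\<Sum>Z\<in>Pow D. (- 1) ^ card Z * (((x + 1) ^ (card U - card Z) - 1) *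
        (?c (Suc (card U) - card Z) - ?c (card U - card Z))))"
    using sum_covering_subsets_exchange[OF Suc.prems(2,3), of x "\<lambda>k. ?c (Suc (card U) - k) - ?c (card U - k)"]
    by simp
  also have "\<dots> = (\<Sum>Z\<in>Pow D. (- 1) ^ card Z * (x * ?c (card U - card Z) +
     ((x + 1) ^ (card U - card Z) - 1) * (?c (Suc (card U) - card Z) - ?c (card U - card Z))))"
    unfolding sum_distrib_left sum.distrib[symmetric]
    by (rule sum.cong) (simp_all only: distrib_left mult.left_commute[of x])
  also have "\<dots> = (\<Sum>Z\<in>Pow D. (- 1) ^ card Z * transfer_coeff x (Suc v) (card U - card Z))"
  proof (rule sum.cong)
    fix Z assume "Z \<in> Pow D"
    \<comment> \<open>By this bound \<open>Suc (card U) - card Z\<close> is the successor of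
      \<open>card U - card Z\<close>, as the recursion demands.\<close>
    then have "card Z \<le> card U" using Suc.prems by (intro card_mono) auto
    then show "(- 1) ^ card Z * (x * ?c (card U - card Z) +
        ((x + 1) ^ (card U - card Z) - 1) * (?c (Suc (card U) - card Z) - ?c (card U - card Z)))
      = (- 1) ^ card Z * transfer_coeff x (Suc v) (card U - card Z)"
      by (simp add: Suc_diff_le)
  qed simp
  finally show ?case .
qed

subsection \<open>Complete homogeneous polynomials\<close>

lemma finite_multisets_of_size:
  assumes "finite I"
  shows "finite {M. set_mset M \<subseteq> I \<and> size M = m}"
proof (induction m)
  case (Suc m)
  have "{M. set_mset M \<subseteq> I \<and> size M = Suc m} \<subseteq> (\<lambda>(a, M). add_mset a M) ` (I \<times> {M. set_mset M \<subseteq> I \<and> size M = m})"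
  proof
    fix M assume M: "M \<in> {M. set_mset M \<subseteq> I \<and> size M = Suc m}"
    then obtain a N where N: "M = add_mset a N" using size_eq_Suc_imp_eq_union[of M m] by blast
    then have "(a, N) \<in> I \<times> {M. set_mset M \<subseteq> I \<and> size M = m}" using M by simp
    then show "M \<in> (\<lambda>(a, M). add_mset a M) ` (I \<times> {M. set_mset M \<subseteq> I \<and> size M = m})"
      unfolding N by (rule rev_image_eqI) simp
  qed
  then show ?case by (rule finite_subset) (use Suc assms in simp)
qed (auto intro: finite_subset[of _ "{{#}}"])

lemma complete_homogeneous_0 [simp]: "complete_homogeneous 0 I y = 1"
proof -
  have "{M. set_mset M \<subseteq> I \<and> size M = 0} = {{#}}" by auto
  then show ?thesis unfolding complete_homogeneous_def by simp
qed

lemma complete_homogeneous_Suc_empty [simp]: "complete_homogeneous (Suc m) {} y = 0"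
  unfolding complete_homogeneous_def by (rule sum.neutral) auto

text \<open>A multiset containing \<open>a\<close> loses one copy of it; any other lives on
  \<open>I\<close>.\<close>

lemma complete_homogeneous_Suc_insert:
  assumes "finite I" "a \<notin> I"
  shows "complete_homogeneous (Suc m) (insert a I) y =
    y a * complete_homogeneous m (insert a I) y + complete_homogeneous (Suc m) I y"
proof -
  let ?S = "{M. set_mset M \<subseteq> insert a I \<and> size M = Suc m}"
    and ?T = "{M. set_mset M \<subseteq> I \<and> size M = Suc m}"
    and ?R = "{M. set_mset M \<subseteq> insert a I \<and> size M = m}"
  have "?S = add_mset a ` ?R \<union> ?T"
  proof (intro equalityI subsetI)
    fix M assume M: "M \<in> ?S"
    show "M \<in> add_mset a ` ?R \<union> ?T"
    proof (cases "a \<in># M")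
      case True
      then obtain N where "M = add_mset a N" by (metis insert_DiffM)
      then show ?thesis using M by auto
    qed (use M in auto)
  qed auto
  moreover have "add_mset a ` ?R \<inter> ?T = {}" using assms(2) by auto
  moreover have "finite ?R" "finite ?T" using assms(1) by (simp_all add: finite_multisets_of_size)
  ultimately show ?thesis
    unfolding complete_homogeneous_def
    by (simp add: sum.union_disjoint sum.reindex inj_on_def sum_distrib_left)
qed

lemma complete_homogeneous_cong:
  assumes "\<And>i. i \<in> I \<Longrightarrow> y i = z i"
  shows "complete_homogeneous m I y = complete_homogeneous m I z"
  unfolding complete_homogeneous_def
  by (intro sum.cong refl arg_cong[of _ _ prod_mset] image_mset_cong) (use assms in auto)

lemma complete_homogeneous_scale:
  "complete_homogeneous m I (\<lambda>i. c * y i) = c ^ m * complete_homogeneous m I y"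
  unfolding complete_homogeneous_def sum_distrib_left
  by (rule sum.cong) (auto simp: prod_mset.distrib)

lemma complete_homogeneous_image:
  assumes "finite I" "inj_on f I"
  shows "complete_homogeneous m (f ` I) y = complete_homogeneous m I (\<lambda>i. y (f i))"
  using assms
proof (induction I arbitrary: m rule: finite_induct)
  case empty
  then show ?case by (cases m) simp_all
next
  case (insert a I)
  \<comment> \<open>The recurrence lowers either the set or only the degree, hence an inner
    induction on the degree.\<close>
  then show ?case
    by (induction m) (auto simp: complete_homogeneous_Suc_insert)
qed

lemma complete_homogeneous_insert_zero:
  assumes "finite I" "a \<notin> I" "y a = 0"
  shows "complete_homogeneous m (insert a I) y = complete_homogeneous m I y"
  using assms by (cases m) (simp_all add: complete_homogeneous_Suc_insert)

text \<open>The recursion sums over paths of \<open>v\<close> steps starting at level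
  \<open>k\<close>. A path with \<open>j\<close> raises collects \<open>q k\<close>, ...,
  \<open>q (k + j - 1)\<close> from them and \<open>q (k + j)\<close> from the initial value; its
  \<open>v - j\<close> stays are distributed freely over the levels \<open>k..k + j\<close>, each
  with weight \<open>x - q i\<close>.\<close>

lemma transfer_coeff_eq:
  fixes x :: "'a::comm_ring_1"
  defines "q \<equiv> \<lambda>i. (x + 1) ^ i - 1"
  shows "transfer_coeff x v k =
     (\<Sum>j\<le>v. prod q {k..k + j} * complete_homogeneous (v - j) {k..k + j} (\<lambda>i. x - q i))"
proof (induction v arbitrary: k)
  case 0
  then show ?case by (simp add: q_def)
next
  case (Suc v)
  let ?h = "\<lambda>m I. complete_homogeneous m I (\<lambda>i. x - q i)"
  have ins: "{k..k + j} = insert k {Suc k..k + j}" for j by auto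
  have "(\<Sum>j\<le>Suc v. prod q {k..k + j} * ?h (Suc v - j) {k..k + j}) =
     (\<Sum>j\<le>v. prod q {k..k + j} * ?h (Suc (v - j)) {k..k + j}) + prod q {k..k + Suc v}"
    by (simp add: Suc_diff_le)
  \<comment> \<open>The recurrence at the variable \<open>k\<close> separates the paths that stay at
    \<open>k\<close> first from those that leave it at once.\<close>
  also have "(\<Sum>j\<le>v. prod q {k..k + j} * ?h (Suc (v - j)) {k..k + j}) =
     (x - q k) * (\<Sum>j\<le>v. prod q {k..k + j} * ?h (v - j) {k..k + j}) +
     (\<Sum>j\<le>v. prod q {k..k + j} * ?h (Suc (v - j)) {Suc k..k + j})"
    unfolding sum_distrib_left sum.distrib[symmetric]
  proof (rule sum.cong)
    fix j
    have "?h (Suc (v - j)) {k..k + j} =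
        (x - q k) * ?h (v - j) {k..k + j} + ?h (Suc (v - j)) {Suc k..k + j}"
      unfolding ins by (subst complete_homogeneous_Suc_insert) auto
    then show "prod q {k..k + j} * ?h (Suc (v - j)) {k..k + j} =
        (x - q k) * (prod q {k..k + j} * ?h (v - j) {k..k + j}) +
        prod q {k..k + j} * ?h (Suc (v - j)) {Suc k..k + j}"
      by (simp only: distrib_left mult.left_commute)
  qed simp
  also have "(\<Sum>j\<le>v. prod q {k..k + j} * ?h (v - j) {k..k + j}) = transfer_coeff x v k"
    using Suc.IH by simp
  also have "(x - q k) * transfer_coeff x v k +
       (\<Sum>j\<le>v. prod q {k..k + j} * ?h (Suc (v - j)) {Suc k..k + j}) + prod q {k..k + Suc v} =
     (x - q k) * transfer_coeff x v k +
       (\<Sum>j\<le>Suc v. prod q {k..k + j} * ?h (Suc v - j) {Suc k..k + j})"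
    by (simp add: Suc_diff_le add.assoc)
  \<comment> \<open>For \<open>j = 0\<close> there are no variables and the degree is positive, so
    this term vanishes before the index shift.\<close>
  also have "(\<Sum>j\<le>Suc v. prod q {k..k + j} * ?h (Suc v - j) {Suc k..k + j}) =
     (\<Sum>j\<le>v. prod q {k..k + Suc j} * ?h (v - j) {Suc k..k + Suc j})"
    by (subst sum.atMost_Suc_shift) simp
  also have "\<dots> = (\<Sum>j\<le>v. q k * (prod q {Suc k..Suc k + j} * ?h (v - j) {Suc k..Suc k + j}))"
  proof (rule sum.cong)
    fix j
    have "prod q {k..k + Suc j} = q k * prod q {Suc k..Suc k + j}"
      unfolding ins by simp
    then show "prod q {k..k + Suc j} * ?h (v - j) {Suc k..k + Suc j} =
        q k * (prod q {Suc k..Suc k + j} * ?h (v - j) {Suc k..Suc k + j})"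
      by (simp add: mult.assoc)
  qed simp
  also have "\<dots> = q k * transfer_coeff x v (Suc k)"
    unfolding sum_distrib_left[symmetric] Suc.IH ..
  finally show ?case by (simp add: q_def algebra_simps)
qed

text \<open>The variable \<open>x - q 1\<close> is 0 and drops out; the others are
  \<open>- (1 + x)\<close> times \<open>q 1\<close>, \<open>q 2\<close>, ..., and homogeneity
  extracts this scalar. The index is \<open>m = n - 1 - j\<close>.\<close>

lemma transfer_coeff_1:
  fixes x :: "'a::comm_ring_1"
  defines "q \<equiv> \<lambda>i. (x + 1) ^ i - 1"
  assumes "1 \<le> n"
  shows "transfer_coeff x (n - 1) 1 =
     (\<Sum>m = 0..n - 2. (- 1) ^ m * (1 + x) ^ m * prod q {1..n - m} *
        complete_homogeneous m {1..n - m - 1} q)"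
proof -
  obtain v where n: "n = Suc v" using assms by (cases n) auto
  let ?t = "\<lambda>m. (- 1) ^ m * (1 + x) ^ m * prod q {1..n - m} * complete_homogeneous m {1..n - m - 1} q"
  have shift: "complete_homogeneous m {1..1 + j} (\<lambda>i. x - q i) =
      (- 1) ^ m * (1 + x) ^ m * complete_homogeneous m {1..j} q" for m j
  proof -
    have "{1..1 + j} = insert 1 (Suc ` {1..j})" by (auto simp: image_Suc_atLeastAtMost)
    then have "complete_homogeneous m {1..1 + j} (\<lambda>i. x - q i) =
        complete_homogeneous m (Suc ` {1..j}) (\<lambda>i. x - q i)"
      using complete_homogeneous_insert_zero[of "Suc ` {1..j}" 1 "\<lambda>i. x - q i" m] by (simp add: q_def)
    also have "\<dots> = complete_homogeneous m {1..j} (\<lambda>i. x - q (Suc i))"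
      by (rule complete_homogeneous_image) auto
    also have "\<dots> = complete_homogeneous m {1..j} (\<lambda>i. (- 1 * (1 + x)) * q i)"
      by (rule complete_homogeneous_cong) (simp add: q_def algebra_simps)
    finally show ?thesis
      by (simp only: complete_homogeneous_scale power_mult_distrib)
  qed
  have "transfer_coeff x (n - 1) 1 =
      (\<Sum>j\<le>v. prod q {1..1 + j} * complete_homogeneous (v - j) {1..1 + j} (\<lambda>i. x - q i))"
    unfolding n q_def by (subst transfer_coeff_eq) simp
  also have "\<dots> = (\<Sum>j\<le>v. ?t (v - j))"
    by (rule sum.cong) (simp_all only: shift n, simp_all add: mult_ac)
  also have "\<dots> = (\<Sum>m\<le>v. ?t m)"
    by (rule sum.reindex_bij_witness[of _ "\<lambda>j. v - j" "\<lambda>j. v - j"]) auto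
  \<comment> \<open>For \<open>n \<ge> 2\<close> the term \<open>m = n - 1\<close> has positive
    degree in no variables and vanishes. For \<open>n = 1\<close> truncation makes both ranges the
    single index 0.\<close>
  also have "\<dots> = (\<Sum>m = 0..n - 2. ?t m)"
    unfolding n by (cases v) (simp_all add: atMost_atLeast0)
  finally show ?thesis .
qed

subsection \<open>Faces of the nonnegative part of an affine space\<close>

definition coord_support :: "real ^ 'e::finite \<Rightarrow> 'e set" where
  "coord_support f = {e. f $ e \<noteq> 0}"

definition support_face :: "(real ^ 'e::finite) set \<Rightarrow> 'e set \<Rightarrow> (real ^ 'e) set" where
  "support_face P S = {f \<in> P. coord_support f \<subseteq> S}"

lemma nonneg_perturb:
  fixes x z :: "real ^ 'e::finite"
  assumes "\<And>e. 0 \<le> x $ e" "coord_support z \<subseteq> coord_support x"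
  obtains t where "0 < t" "\<And>e. 0 \<le> (x + t *\<^sub>R z) $ e"
proof
  \<comment> \<open>A lower bound for the positive coordinates of \<open>x\<close>; the value 1 at
    zero coordinates keeps the minimum positive.\<close>
  define m where "m = Min (range (\<lambda>e. if x $ e = 0 then 1 else x $ e))"
  have m: "0 < m" unfolding m_def by (subst Min_gr_iff) (auto simp: order_less_le assms(1))
  \<comment> \<open>No coordinate of \<open>t *\<^sub>R z\<close> exceeds \<open>m\<close> in
    absolute value; adding 1 covers \<open>z = 0\<close>.\<close>
  define t where "t = m / (1 + norm z)"
  show t: "0 < t" unfolding t_def using m by (simp add: add_pos_nonneg)
  show "0 \<le> (x + t *\<^sub>R z) $ e" for e
  proof (cases "x $ e = 0")
    case True
    then have "z $ e = 0" using assms(2) unfolding coord_support_def by auto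
    then show ?thesis using assms(1) by simp
  next
    case False
    have "m \<le> (if x $ e = 0 then 1 else x $ e)" unfolding m_def by (rule Min_le) auto
    then have "m \<le> x $ e" using False by simp
    moreover have "t * \<bar>z $ e\<bar> \<le> t * (1 + norm z)"
      using t component_le_norm_cart[of z e] by (intro mult_left_mono) auto
    moreover have "t * (1 + norm z) = m"
      unfolding t_def using norm_ge_zero[of z] by (simp add: add_nonneg_eq_0_iff)
    moreover have "- (t * \<bar>z $ e\<bar>) \<le> t * z $ e"
      using mult_left_mono[of "- \<bar>z $ e\<bar>" "z $ e" t] t by simp
    ultimately show ?thesis by simp
  qed
qed

locale nonneg_affine =
  fixes L :: "(real ^ 'e::finite) set" and P
  assumes affine: "affine L"
  defines "P \<equiv> {f \<in> L. \<forall>e. 0 \<le> f $ e}"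
begin

lemma convex_P: "convex P"
proof -
  have "P = L \<inter> {f. \<forall>e. 0 \<le> f $ e}" unfolding P_def by auto
  moreover have "convex {f :: real ^ 'e. \<forall>e. 0 \<le> f $ e}" unfolding convex_def by simp
  ultimately show ?thesis using convex_Int[OF affine_imp_convex[OF affine]] by presburger
qed

text \<open>A combination of two nonnegative numbers with positive weights is 0 only if both are, so
  a zero coordinate inside a segment is zero at its ends.\<close>

lemma support_face_face_of: "support_face P S face_of P"
proof -
  have "a \<in> support_face P S \<and> b \<in> support_face P S"
    if a: "a \<in> P" and b: "b \<in> P" and x: "x \<in> support_face P S" "x \<in> open_segment a b" for a b x
  proof -
    obtain u where u: "0 < u" "u < 1" and xu: "x = (1 - u) *\<^sub>R a + u *\<^sub>R b"
      using x(2) unfolding in_segment by blast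
    have "a $ e = 0 \<and> b $ e = 0" if "e \<notin> S" for e
    proof -
      have "x $ e = 0" using x(1) that unfolding support_face_def coord_support_def by auto
      then have "(1 - u) * a $ e + u * b $ e = 0" by (simp add: xu)
      moreover have "0 \<le> a $ e" "0 \<le> b $ e" using a b unfolding P_def by auto
      ultimately show ?thesis
        using u by (simp add: add_nonneg_eq_0_iff)
    qed
    then show ?thesis using a b unfolding support_face_def coord_support_def by auto
  qed
  moreover have "convex (support_face P S)"
  proof -
    have "support_face P S = P \<inter> {f. \<forall>e. e \<notin> S \<longrightarrow> f $ e = 0}"
      unfolding support_face_def coord_support_def by auto
    moreover have "convex {f :: real ^ 'e. \<forall>e. e \<notin> S \<longrightarrow> f $ e = 0}" unfolding convex_def by simp
    ultimately show ?thesis using convex_Int[OF convex_P] by presburger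
  qed
  moreover have "support_face P S \<subseteq> P" unfolding support_face_def by blast
  ultimately show ?thesis unfolding face_of_def by blast
qed

text \<open>A point of \<open>F\<close> with as many nonzero coordinates as possible lies in the relative interior.\<close>

lemma face_of_imp_support_face:
  assumes F: "F face_of P" and ne: "F \<noteq> {}"
  obtains x where "x \<in> P" "F = support_face P (coord_support x)"
proof -
  have "finite (range (card \<circ> (coord_support :: real ^ 'e \<Rightarrow> 'e set)))"
    unfolding image_comp[symmetric] by simp
  then have fin: "finite ((card \<circ> coord_support) ` F)" by (rule finite_subset[rotated]) auto
  then have "Max ((card \<circ> coord_support) ` F) \<in> (card \<circ> coord_support) ` F"
    using ne by (intro Max_in) auto
  then obtain x where x: "x \<in> F" and "card (coord_support x) = Max ((card \<circ> coord_support) ` F)" by auto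
  then have max: "card (coord_support y) \<le> card (coord_support x)" if "y \<in> F" for y
    using Max_ge[OF fin, of "card (coord_support y)"] that by auto
  have FP: "F \<subseteq> P" and convF: "convex F" using F unfolding face_of_def by auto
  have "coord_support y \<subseteq> coord_support x" if y: "y \<in> F" for y
  proof -
    \<comment> \<open>Nonnegative coordinates cannot cancel, so the midpoint has the union of both
      supports, and maximality of \<open>x\<close> applies to it.\<close>
    let ?z = "(1 / 2) *\<^sub>R x + (1 / 2) *\<^sub>R y"
    have "?z \<in> F" using convexD[OF convF x y, of "1/2" "1/2"] by simp
    then have "card (coord_support ?z) \<le> card (coord_support x)" by (rule max)
    moreover have z: "coord_support ?z = coord_support x \<union> coord_support y"
    proof -
      have "x $ e + y $ e = 0 \<longleftrightarrow> x $ e = 0 \<and> y $ e = 0" for e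
        using x y FP unfolding P_def by (intro add_nonneg_eq_0_iff) auto
      then show ?thesis unfolding coord_support_def by (auto simp: field_simps)
    qed
    ultimately have "coord_support x = coord_support ?z" by (intro card_seteq) auto
    then show ?thesis using z by auto
  qed
  moreover have "y \<in> F" if y: "y \<in> P" "coord_support y \<subseteq> coord_support x" for y
  proof (cases "y = x")
    case False
    have xP: "x \<in> P" using x FP by auto
    \<comment> \<open>The segment from \<open>y\<close> to \<open>x\<close> can be prolonged
      slightly beyond \<open>x\<close> within \<open>P\<close>. Then \<open>x\<close> is an interior
      point of it, and the face property puts \<open>y\<close> into \<open>F\<close>.\<close>
    have "coord_support (x - y) \<subseteq> coord_support x" using y(2) unfolding coord_support_def by auto
    then obtain t where t: "0 < t" and nn: "\<And>e. 0 \<le> (x + t *\<^sub>R (x - y)) $ e"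
      using nonneg_perturb[of x "x - y"] xP unfolding P_def by blast
    let ?w = "x + t *\<^sub>R (x - y)"
    have "?w = (1 + t) *\<^sub>R x + (- t) *\<^sub>R y" by (simp add: algebra_simps)
    also have "\<dots> \<in> L" using xP y(1) unfolding P_def by (intro mem_affine[OF affine]) auto
    finally have wP: "?w \<in> P" using nn unfolding P_def by auto
    have "y \<noteq> ?w"
    proof
      assume "y = ?w"
      then have "(1 + t) *\<^sub>R (x - y) = 0" by (simp add: algebra_simps)
      then show False using t False by simp
    qed
    moreover have "x = (1 - 1 / (1 + t)) *\<^sub>R y + (1 / (1 + t)) *\<^sub>R ?w"
    proof -
      have "(1 + t) *\<^sub>R x = t *\<^sub>R y + ?w" by (simp add: algebra_simps)
      then have "x = (1 / (1 + t)) *\<^sub>R (t *\<^sub>R y + ?w)" using t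
        by (metis add_pos_pos divide_self_if less_irrefl scaleR_one
            scaleR_scaleR times_divide_eq_left mult_1 zero_less_one)
      moreover have "1 - 1 / (1 + t) = t / (1 + t)" using t by (simp add: field_simps)
      ultimately show ?thesis by (simp add: scaleR_add_right)
    qed
    ultimately have "x \<in> open_segment y ?w"
      unfolding in_segment using t by (intro conjI exI[of _ "1 / (1 + t)"]) auto
    then show ?thesis using F x y(1) wP unfolding face_of_def by blast
  qed (use x in simp)
  ultimately have "F = support_face P (coord_support x)"
    using FP unfolding support_face_def by blast
  then show ?thesis using that x FP by blast
qed

text \<open>A support is recovered from its face because the point realizing it lies in that face
  and has the largest support there.\<close>

lemma bij_betw_support_face:
  "bij_betw (support_face P) (coord_support ` P) {F. F face_of P \<and> F \<noteq> {}}"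
  unfolding bij_betw_def
proof (intro conjI)
  have "coord_support x \<subseteq> coord_support y"
    if "x \<in> P" "support_face P (coord_support x) = support_face P (coord_support y)" for x y
    using that unfolding support_face_def by blast
  then show "inj_on (support_face P) (coord_support ` P)"
    unfolding inj_on_def by (metis (no_types, lifting) imageE subset_antisym)
  show "support_face P ` coord_support ` P = {F. F face_of P \<and> F \<noteq> {}}"
  proof (intro equalityI subsetI)
    fix F assume "F \<in> support_face P ` coord_support ` P"
    then show "F \<in> {F. F face_of P \<and> F \<noteq> {}}"
      using support_face_face_of by (auto simp: support_face_def)
  next
    fix F assume "F \<in> {F. F face_of P \<and> F \<noteq> {}}"
    then show "F \<in> support_face P ` coord_support ` P" using face_of_imp_support_face[of F] by blast
  qed
qed

lemma finite_faces: "finite {F. F face_of P}"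
proof -
  have "finite {F. F face_of P \<and> F \<noteq> {}}"
    using bij_betw_finite[OF bij_betw_support_face] by simp
  moreover have "{F. F face_of P} \<subseteq> insert {} {F. F face_of P \<and> F \<noteq> {}}" by auto
  ultimately show ?thesis using finite_subset by blast
qed

text \<open>Ungrouping the faces by dimension gives one monomial per face; the empty face, of
  dimension -1, gives the separate \<open>1 / fls_X\<close>.\<close>

lemma f_vector_eq_sum_supports:
  "f_vector P = 1 / fls_X + (\<Sum>S\<in>coord_support ` P. fls_X powi aff_dim (support_face P S))"
proof -
  let ?F = "{F. F face_of P}" and ?g = "\<lambda>F. fls_X powi aff_dim F :: rat fls"
  have "f_vector P = (\<Sum>d = -1..aff_dim P. \<Sum>F\<in>{F\<in>?F. aff_dim F = d}. ?g F)"
    unfolding f_vector_def face_count_def by (rule sum.cong) simp_all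
  also have "\<dots> = (\<Sum>F\<in>?F. ?g F)"
  proof (rule sum.group[OF finite_faces])
    show "aff_dim ` ?F \<subseteq> {- 1..aff_dim P}"
      using aff_dim_geq by (auto simp: face_of_imp_subset aff_dim_subset)
  qed simp
  also have "\<dots> = ?g {} + (\<Sum>F\<in>?F - {{}}. ?g F)"
    using sum.remove[OF finite_faces, of "{}" ?g] by simp
  also have "?F - {{}} = {F. F face_of P \<and> F \<noteq> {}}" by auto
  also have "(\<Sum>F\<in>\<dots>. ?g F) = (\<Sum>S\<in>coord_support ` P. ?g (support_face P S))"
    by (rule sum.reindex_bij_betw[OF bij_betw_support_face, symmetric])
  finally show ?thesis by (simp add: divide_inverse)
qed

end

text \<open>Translated by \<open>- x\<close>, the set lies in \<open>V\<close> and contains a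
  positive multiple of each vector of \<open>V\<close>, hence spans \<open>V\<close>.\<close>

lemma aff_dim_eq_dim_directions:
  fixes x :: "'a::euclidean_space"
  assumes "subspace V" and "\<And>y. y \<in> Q \<Longrightarrow> y - x \<in> V"
    and "\<And>z. z \<in> V \<Longrightarrow> \<exists>t>0. x + t *\<^sub>R z \<in> Q" and "x \<in> Q"
  shows "aff_dim Q = int (dim V)"
proof -
  let ?Q = "(+) (- x) ` Q"
  have "0 \<in> ?Q" using assms(4) by (auto intro: rev_image_eqI)
  then have "aff_dim ?Q = int (dim ?Q)" by (intro aff_dim_zero hull_inc)
  moreover have "span ?Q = V"
  proof (rule span_subspace[OF _ _ assms(1)])
    show "?Q \<subseteq> V" using assms(2) by auto
    show "V \<subseteq> span ?Q"
    proof
      fix z assume "z \<in> V"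
      then obtain t where t: "0 < t" "x + t *\<^sub>R z \<in> Q" using assms(3) by blast
      then have "t *\<^sub>R z \<in> span ?Q" by (intro span_base rev_image_eqI[OF t(2)]) simp
      then have "(1 / t) *\<^sub>R t *\<^sub>R z \<in> span ?Q" by (rule span_scale)
      then show "z \<in> span ?Q" using t by simp
    qed
  qed
  ultimately show ?thesis by (metis aff_dim_translation_eq dim_span)
qed

subsection \<open>Supports and faces for unit flows\<close>

lemma power_int_diff_eq:
  fixes X :: "'a::field"
  assumes "X \<noteq> 0" "b \<le> n"
  shows "X powi (int a - int b) = 1 / X ^ n * X ^ (a + (n - b))"
  using assms by (simp add: power_int_diff power_add power_diff)

text \<open>The common kernel is the orthogonal complement within \<open>B\<close> of the span of
  the \<open>b i\<close>, whose dimension is \<open>card V\<close>.\<close>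

lemma dim_common_kernel:
  fixes b :: "'i \<Rightarrow> real ^ 'e::finite"
  assumes V: "finite V" and B: "subspace B" "b ` V \<subseteq> B"
    and indep: "\<And>c. (\<Sum>i\<in>V. c i *\<^sub>R b i) = 0 \<Longrightarrow> \<forall>i\<in>V. c i = 0"
  shows "dim {y \<in> B. \<forall>i\<in>V. b i \<bullet> y = 0} + card V = dim B"
proof -
  have inj: "inj_on b V"
  proof (rule inj_onI, rule ccontr)
    fix i j assume ij: "i \<in> V" "j \<in> V" "b i = b j" "i \<noteq> j"
    \<comment> \<open>Equal vectors at two indices would give a relation with coefficients 1 and
      -1.\<close>
    have "(\<Sum>k\<in>V. (of_bool (k = i) - of_bool (k = j)) *\<^sub>R b k) =
        (\<Sum>k\<in>V. if k = i then b k else 0) - (\<Sum>k\<in>V. if k = j then b k else 0)"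
      unfolding sum_subtractf[symmetric] by (rule sum.cong) auto
    also have "\<dots> = 0" using ij V by simp
    finally have "\<forall>k\<in>V. of_bool (k = i) - of_bool (k = j) = (0 :: real)" by (rule indep)
    then show False using ij(1,4) by auto
  qed
  have "independent (b ` V)"
  proof (rule ccontr)
    assume "\<not> independent (b ` V)"
    then obtain u where u: "\<exists>v\<in>b ` V. u v \<noteq> 0" "(\<Sum>v\<in>b ` V. u v *\<^sub>R v) = 0"
      using dependent_finite[of "b ` V"] V by auto
    then have "(\<Sum>i\<in>V. u (b i) *\<^sub>R b i) = 0" using inj by (simp add: sum.reindex)
    then show False using indep[of "\<lambda>i. u (b i)"] u(1) by auto
  qed
  then have dimA: "dim (span (b ` V)) = card V"
    using dim_eq_card_independent[of "b ` V"] card_image[OF inj] by simp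
  have sub: "span (b ` V) \<subseteq> B" by (rule span_minimal[OF B(2,1)])
  have "dim {y \<in> B. \<forall>x\<in>span (b ` V). orthogonal x y} + card V = dim B"
    using dim_subspace_orthogonal_to_vectors[OF subspace_span B(1) sub] unfolding dimA .
  moreover have "(\<forall>x\<in>span (b ` V). orthogonal x y) \<longleftrightarrow> (\<forall>i\<in>V. b i \<bullet> y = 0)" for y
  proof
    assume "\<forall>x\<in>span (b ` V). orthogonal x y"
    then show "\<forall>i\<in>V. b i \<bullet> y = 0" using span_base[of _ "b ` V"] by (auto simp: orthogonal_def)
  next
    assume y: "\<forall>i\<in>V. b i \<bullet> y = 0"
    have "orthogonal y x" if "x \<in> span (b ` V)" for x
      by (rule orthogonal_to_span[OF that]) (use y in \<open>auto simp: orthogonal_def inner_commute\<close>)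
    then show "\<forall>x\<in>span (b ` V). orthogonal x y" by (simp add: orthogonal_commute)
  qed
  ultimately show ?thesis by simp
qed

text \<open>The amount passing through \<open>i\<close> when one unit starts at vertex 1. The guard
  \<open>fst (ends e) < i\<close> makes the recursion terminate for arbitrary
  \<open>ends\<close>.\<close>

function flow_mass :: "('e::finite \<Rightarrow> nat \<times> nat) \<Rightarrow> 'e set \<Rightarrow> nat \<Rightarrow> real" where
  "flow_mass ends S i = (if i = 1 then 1 else
     \<Sum>e\<in>{e \<in> S. snd (ends e) = i \<and> fst (ends e) < i}.
       flow_mass ends S (fst (ends e)) / real (card {e' \<in> S. fst (ends e') = fst (ends e)}))"
  by auto
termination by (relation "Wellfounded.measure (\<lambda>(_, _, i). i)") auto

declare flow_mass.simps [simp del]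

locale complete_graph =
  fixes n :: nat and ends :: "'e::finite \<Rightarrow> nat \<times> nat"
  assumes n: "1 \<le> n" and ends: "bij_betw ends UNIV (complete_edges n)"
begin

definition divergence :: "nat \<Rightarrow> real ^ 'e \<Rightarrow> real" where
  "divergence i f = (\<Sum>e | fst (ends e) = i. f $ e) - (\<Sum>e | snd (ends e) = i. f $ e)"

definition flow_space :: "(real ^ 'e) set" where
  "flow_space = {f. \<forall>i\<in>{1..n}. divergence i f = (if i = 1 then 1 else 0)}"

lemma inj_ends: "inj ends" and range_ends: "range ends = complete_edges n"
  using ends unfolding bij_betw_def by auto

lemma ends_bounds: "1 \<le> fst (ends e)" "fst (ends e) < snd (ends e)" "snd (ends e) \<le> Suc n"
  using range_ends unfolding complete_edges_def
  by (metis (mono_tags, lifting) Suc_eq_plus1 UNIV_I case_prodD image_eqI mem_Collect_eq prod.collapse)+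

lemma divergence_add: "divergence i (f + g) = divergence i f + divergence i g"
  and divergence_scale: "divergence i (c *\<^sub>R f) = c * divergence i f"
  unfolding divergence_def by (simp_all add: sum.distrib sum_distrib_left algebra_simps)

lemma affine_flow_space: "affine flow_space"
  unfolding affine_def flow_space_def
  by (auto simp: divergence_add divergence_scale algebra_simps)

lemma CRY_eq: "CRY ends n = {f \<in> flow_space. \<forall>e. 0 \<le> f $ e}"
  unfolding CRY_def flow_polytope_def flow_space_def divergence_def by auto

sublocale nonneg_affine flow_space "CRY ends n"
  unfolding CRY_eq by unfold_locales (rule affine_flow_space)

text \<open>A sum of nonnegative values is nonzero iff some term is, so conservation matches tails
  with heads; vertex 1 receives nothing and emits one unit.\<close>

lemma support_covering:
  assumes f: "f \<in> CRY ends n"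
  shows "ends ` coord_support f \<in> covering_graphs n {Suc n} {}"
proof -
  let ?S = "coord_support f"
  have nn: "0 \<le> f $ e" for e using f unfolding CRY_eq by auto
  have div: "divergence i f = (if i = 1 then 1 else 0)" if "i \<in> {1..n}" for i
    using f that unfolding CRY_eq flow_space_def by auto
  have out: "i \<in> fst ` ends ` ?S \<longleftrightarrow> (\<Sum>e | fst (ends e) = i. f $ e) \<noteq> 0" for i
    by (subst sum_nonneg_eq_0_iff) (auto simp: nn coord_support_def image_iff)
  have inc: "i \<in> snd ` ends ` ?S \<longleftrightarrow> (\<Sum>e | snd (ends e) = i. f $ e) \<noteq> 0" for i
    by (subst sum_nonneg_eq_0_iff) (auto simp: nn coord_support_def image_iff)
  have "{e. snd (ends e) = 1} = {}"
    using ends_bounds(1,2) by (metis (mono_tags, lifting) Collect_empty_eq not_less)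
  then have "1 \<in> fst ` ends ` ?S" using div[of 1] n unfolding out divergence_def by simp
  moreover have "i \<in> fst ` ends ` ?S \<longleftrightarrow> i \<in> snd ` ends ` ?S" if "i \<in> {2..n}" for i
    using div[of i] that unfolding out inc divergence_def by auto
  moreover have "1 \<le> i \<and> i \<le> n \<and> i < j \<and> (j \<le> n \<or> j \<in> {Suc n})" if ij: "(i, j) \<in> ends ` ?S" for i j
  proof -
    obtain e where "(i, j) = ends e" using ij by blast
    then show ?thesis using ends_bounds[of e]
      by (metis fst_conv snd_conv le_Suc_eq less_Suc_eq_le less_le_trans singletonI)
  qed
  ultimately show ?thesis unfolding covering_graphs_def by blast
qed

section \<open>Realizing a covering edge set as the support of a flow\<close>

lemma covering_conserved:
  assumes "ends ` S \<in> covering_graphs n {Suc n} {}"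
  shows "1 \<in> fst ` ends ` S" "i \<in> {2..n} \<Longrightarrow> i \<in> fst ` ends ` S \<longleftrightarrow> i \<in> snd ` ends ` S"
    and "fst ` ends ` S \<subseteq> {1..n}"
  using assms covering_graphs_tails[OF assms] unfolding covering_graphs_def by auto

text \<open>A tail other than 1 has an incoming edge in \<open>S\<close>, and its positive mass is
  inherited from smaller tails.\<close>

lemma flow_mass_pos:
  assumes S: "ends ` S \<in> covering_graphs n {Suc n} {}"
  shows "i \<in> fst ` ends ` S \<Longrightarrow> 0 < flow_mass ends S i"
proof (induction i rule: less_induct)
  case (less i)
  show ?case
  proof (cases "i = 1")
    case False
    then have i: "i \<in> {2..n}" using less.prems covering_conserved(3)[OF S] by fastforce
    then have "i \<in> snd ` ends ` S" using less.prems covering_conserved(2)[OF S] by blast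
    then have ne: "{e \<in> S. snd (ends e) = i \<and> fst (ends e) < i} \<noteq> {}" using ends_bounds(2) by fastforce
    have "0 < flow_mass ends S (fst (ends e)) / real (card {e' \<in> S. fst (ends e') = fst (ends e)})"
      if "e \<in> S" "fst (ends e) < i" for e
    proof -
      have "0 < flow_mass ends S (fst (ends e))" using less.IH that by blast
      moreover have "0 < card {e' \<in> S. fst (ends e') = fst (ends e)}"
        using that(1) by (auto simp: card_gt_0_iff)
      ultimately show ?thesis by simp
    qed
    then have "0 < (\<Sum>e\<in>{e \<in> S. snd (ends e) = i \<and> fst (ends e) < i}.
        flow_mass ends S (fst (ends e)) / real (card {e' \<in> S. fst (ends e') = fst (ends e)}))"
      using ne by (intro sum_pos) auto
    then show ?thesis using False by (subst flow_mass.simps) simp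
  qed (simp add: flow_mass.simps)
qed

text \<open>Every vertex splits the flow it receives evenly among its outgoing edges in \<open>S\<close>.\<close>

lemma covering_support:
  assumes S: "ends ` S \<in> covering_graphs n {Suc n} {}"
  shows "S \<in> coord_support ` CRY ends n"
proof -
  let ?m = "flow_mass ends S" and ?d = "\<lambda>i. real (card {e' \<in> S. fst (ends e') = i})"
  define f :: "real ^ 'e" where "f = (\<chi> e. if e \<in> S then ?m (fst (ends e)) / ?d (fst (ends e)) else 0)"
  have d: "0 < ?d (fst (ends e))" if "e \<in> S" for e
    using that by (auto simp: card_gt_0_iff)
  have pos: "0 < f $ e" if "e \<in> S" for e
  proof -
    have "0 < ?m (fst (ends e))" using that by (intro flow_mass_pos[OF S]) auto
    then show ?thesis unfolding f_def using that d[OF that] by simp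
  qed
  have out: "(\<Sum>e | fst (ends e) = i. f $ e) = (if i \<in> fst ` ends ` S then ?m i else 0)" for i
  proof -
    have "(\<Sum>e | fst (ends e) = i. f $ e) = (\<Sum>e\<in>{e \<in> S. fst (ends e) = i}. ?m i / ?d i)"
      by (rule sum.mono_neutral_cong_right) (auto simp: f_def)
    also have "\<dots> = (if i \<in> fst ` ends ` S then ?m i else 0)"
      using d by (auto simp: image_iff)
    finally show ?thesis .
  qed
  \<comment> \<open>Every edge satisfies the guard of \<open>flow_mass\<close>, so the inflow is
    exactly the sum in its recursion.\<close>
  have inc: "(\<Sum>e | snd (ends e) = i. f $ e) =
      (\<Sum>e\<in>{e \<in> S. snd (ends e) = i \<and> fst (ends e) < i}. ?m (fst (ends e)) / ?d (fst (ends e)))" for i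
    using ends_bounds(2) by (intro sum.mono_neutral_cong_right) (auto simp: f_def)
  have "divergence i f = (if i = 1 then 1 else 0)" if i: "i \<in> {1..n}" for i
  proof (cases "i = 1")
    case True
    have "{e \<in> S. snd (ends e) = 1 \<and> fst (ends e) < 1} = {}" using ends_bounds(1) by (auto simp: Suc_le_eq)
    then show ?thesis
      using covering_conserved(1)[OF S] True flow_mass.simps[of ends S 1]
      unfolding divergence_def out inc by simp
  next
    case False
    then have "i \<in> {2..n}" using i by auto
    note iff = covering_conserved(2)[OF S this]
    show ?thesis
    proof (cases "i \<in> fst ` ends ` S")
      case True
      then show ?thesis
        using False flow_mass.simps[of ends S i] unfolding divergence_def out inc by simp
    next
      case noout: False
      then have empty: "{e \<in> S. snd (ends e) = i \<and> fst (ends e) < i} = {}" using iff by auto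
      show ?thesis using False noout unfolding divergence_def out inc empty by simp
    qed
  qed
  moreover have "0 \<le> f $ e" for e using pos[of e] by (cases "e \<in> S") (auto simp: f_def)
  ultimately have "f \<in> CRY ends n" unfolding CRY_eq flow_space_def by auto
  moreover have "coord_support f = S"
    unfolding coord_support_def using pos by (force simp: f_def)
  ultimately show ?thesis by blast
qed

lemma bij_betw_supports:
  "bij_betw ((`) ends) (coord_support ` CRY ends n) (covering_graphs n {Suc n} {})"
  unfolding bij_betw_def
proof (intro conjI equalityI subsetI)
  show "inj_on ((`) ends) (coord_support ` CRY ends n)"
    using inj_ends by (auto simp: inj_on_def inj_image_eq_iff)
next
  fix E assume "E \<in> (`) ends ` coord_support ` CRY ends n"
  then show "E \<in> covering_graphs n {Suc n} {}" using support_covering by blast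
next
  fix E assume E: "E \<in> covering_graphs n {Suc n} {}"
  then have "E \<subseteq> range ends"
    unfolding range_ends complete_edges_def covering_graphs_def by force
  then have "E = ends ` (ends -` E)" by auto
  then show "E \<in> (`) ends ` coord_support ` CRY ends n"
    using covering_support[of "ends -` E"] E by (metis image_eqI)
qed

text \<open>From \<open>x\<close> one can move within the face in exactly the directions supported
  on \<open>S\<close> with divergence 0; each tail imposes one independent linear condition on
  them.\<close>

lemma aff_dim_support_face:
  assumes x: "x \<in> CRY ends n"
  defines "S \<equiv> coord_support x"
  shows "aff_dim (support_face (CRY ends n) S) = int (card S) - int (card (fst ` ends ` S))"
proof -
  let ?V = "fst ` ends ` S"
  let ?B = "{z :: real ^ 'e. \<forall>e. e \<notin> S \<longrightarrow> z $ e = 0}"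
  \<comment> \<open>The coefficient vector of the divergence at \<open>i\<close>, restricted to
    \<open>S\<close>.\<close>
  let ?b = "\<lambda>i. (\<chi> e. if e \<in> S then of_bool (fst (ends e) = i) - of_bool (snd (ends e) = i) else 0) :: real ^ 'e"
  let ?L = "{z \<in> ?B. \<forall>i\<in>?V. ?b i \<bullet> z = 0}"
  note S = support_covering[OF x, folded S_def]
  have sub: "subspace ?B" by (auto simp: subspace_def)
  have div: "?b i \<bullet> z = divergence i z" if "z \<in> ?B" for i z
  proof -
    have "?b i \<bullet> z = (\<Sum>e\<in>UNIV. (of_bool (fst (ends e) = i) - of_bool (snd (ends e) = i)) * z $ e)"
      unfolding inner_vec_def using that by (intro sum.cong) auto
    also have "\<dots> = divergence i z"
      unfolding divergence_def left_diff_distrib sum_subtractf of_bool_def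
      by (simp add: sum.If_cases if_distrib[of "\<lambda>a. a * _"] Int_def cong: if_cong)
    finally show ?thesis .
  qed
  \<comment> \<open>The conditions at the tails suffice: any other vertex up to \<open>n\<close>
    meets no edge of \<open>S\<close>.\<close>
  have zero: "divergence i z = 0" if "z \<in> ?L" "i \<in> {1..n}" for i z
  proof (cases "i \<in> ?V")
    case True
    then have "?b i \<bullet> z = 0" using that(1) by blast
    then show ?thesis using that(1) div[of z i] by simp
  next
    case False
    then have "i \<in> {2..n}" using that(2) covering_conserved(1)[OF S] by (cases "i = 1") auto
    then have "i \<notin> snd ` ends ` S" using False covering_conserved(2)[OF S] by blast
    then have "e \<notin> S" if "fst (ends e) = i \<or> snd (ends e) = i" for e using that False by auto
    then show ?thesis using that(1) unfolding divergence_def by simp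
  qed
  have "aff_dim (support_face (CRY ends n) S) = int (dim ?L)"
  proof (rule aff_dim_eq_dim_directions[where x = x])
    show "subspace ?L" by (auto simp: subspace_def inner_add_right)
    show xQ: "x \<in> support_face (CRY ends n) S" unfolding support_face_def S_def using x by simp
    show "y - x \<in> ?L" if y: "y \<in> support_face (CRY ends n) S" for y
    proof -
      have "y $ e = 0 \<and> x $ e = 0" if "e \<notin> S" for e
        using y xQ that unfolding support_face_def coord_support_def by blast
      then have yx: "y - x \<in> ?B" by simp
      have d: "divergence i (y - x) = 0" if "i \<in> {1..n}" for i
        using x y that divergence_add[of i "y - x" x]
        unfolding support_face_def CRY_eq flow_space_def by auto
      have "?b i \<bullet> (y - x) = 0" if "i \<in> ?V" for i
        using d[OF subsetD[OF covering_conserved(3)[OF S] that]] div[OF yx, of i] by (rule trans[rotated])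
      then show ?thesis using yx by blast
    qed
    show "\<exists>t>0. x + t *\<^sub>R z \<in> support_face (CRY ends n) S" if z: "z \<in> ?L" for z
    proof -
      have "coord_support z \<subseteq> coord_support x" using z unfolding coord_support_def S_def by auto
      then obtain t where t: "0 < t" "\<And>e. 0 \<le> (x + t *\<^sub>R z) $ e"
        using nonneg_perturb[of x z] x unfolding CRY_eq by blast
      have "x + t *\<^sub>R z \<in> flow_space"
        using x zero[OF z] unfolding CRY_eq flow_space_def by (simp add: divergence_add divergence_scale)
      moreover have "coord_support (x + t *\<^sub>R z) \<subseteq> S"
        using z unfolding S_def coord_support_def by auto
      ultimately have "x + t *\<^sub>R z \<in> support_face (CRY ends n) S"
        using t(2) unfolding support_face_def CRY_eq by blast
      then show ?thesis using t(1) by blast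
    qed
  qed
  moreover have "dim ?L + card ?V = dim ?B"
  proof (rule dim_common_kernel[OF _ sub])
    show "?b ` ?V \<subseteq> ?B" by auto
    fix c assume c0: "(\<Sum>i\<in>?V. c i *\<^sub>R ?b i) = 0"
    \<comment> \<open>An edge \<open>e\<close> has entry 1 at its tail and -1 at its head, and the
      head occurs in the relation only if it is itself a tail.\<close>
    have edge: "c (fst (ends e)) = (if snd (ends e) \<in> ?V then c (snd (ends e)) else 0)" if e: "e \<in> S" for e
    proof -
      have "0 = (\<Sum>i\<in>?V. c i *\<^sub>R ?b i) $ e" unfolding c0 by simp
      also have "\<dots> = (\<Sum>i\<in>?V. (if fst (ends e) = i then c i else 0) - (if snd (ends e) = i then c i else 0))"
        using e by (auto simp: sum_component intro!: sum.cong)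
      also have "\<dots> = c (fst (ends e)) - (if snd (ends e) \<in> ?V then c (snd (ends e)) else 0)"
        using e by (simp add: sum_subtractf)
      finally show ?thesis by simp
    qed
    \<comment> \<open>Downward induction on the vertices: some edge of \<open>S\<close> leaves
      \<open>i\<close>, and its larger head contributes 0, by induction or because it is no
      tail.\<close>
    have "i \<in> ?V \<longrightarrow> c i = 0" for i
    proof (induction "Suc n - i" arbitrary: i rule: less_induct)
      case less
      show ?case
      proof
        assume i: "i \<in> ?V"
        then obtain e where e: "e \<in> S" "fst (ends e) = i" by auto
        have "Suc n - snd (ends e) < Suc n - i"
          using subsetD[OF covering_conserved(3)[OF S] i] ends_bounds(2)[of e] e(2)
          by (intro diff_less_mono2) auto
        then show "c i = 0" using less[of "snd (ends e)"] edge[OF e(1)] e(2) by auto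
      qed
    qed
    then show "\<forall>i\<in>?V. c i = 0" by blast
  qed simp
  moreover have "dim ?B = card S"
    using dim_substandard_cart[of S, where 'a = real] by (simp add: dim_vec_eq)
  ultimately show ?thesis by linarith
qed

lemma f_vector_CRY:
  "f_vector (CRY ends n) = 1 / fls_X + 1 / fls_X ^ n *
     (\<Sum>E\<in>covering_graphs n {Suc n} {}. covering_weight n fls_X E)"
proof -
  let ?g = "\<lambda>E :: (nat \<times> nat) set. fls_X powi (int (card E) - int (card (fst ` E))) :: rat fls"
  have "(\<Sum>S\<in>coord_support ` CRY ends n. fls_X powi aff_dim (support_face (CRY ends n) S)) =
      (\<Sum>S\<in>coord_support ` CRY ends n. ?g (ends ` S))"
    using aff_dim_support_face inj_ends by (auto intro!: sum.cong simp: card_image inj_on_subset)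
  also have "\<dots> = (\<Sum>E\<in>covering_graphs n {Suc n} {}. ?g E)"
    by (rule sum.reindex_bij_betw[OF bij_betw_supports])
  also have "\<dots> = (\<Sum>E\<in>covering_graphs n {Suc n} {}. 1 / fls_X ^ n * covering_weight n fls_X E)"
  proof (rule sum.cong)
    fix E assume E: "E \<in> covering_graphs n {Suc n} {}"
    \<comment> \<open>With at most \<open>n\<close> tails, the exponent shifted by \<open>n\<close>
      is a natural number.\<close>
    have "card (fst ` E) \<le> n"
      using card_mono[OF _ covering_graphs_tails[OF E]] by simp
    then show "?g E = 1 / fls_X ^ n * covering_weight n fls_X E"
      unfolding covering_weight_def by (intro power_int_diff_eq) simp_all
  qed simp
  finally show ?thesis
    unfolding f_vector_eq_sum_supports sum_distrib_left by simp
qed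

end

theorem corollary4p2:
  fixes n :: nat and ends :: "'e::finite \<Rightarrow> nat \<times> nat"
  assumes "n \<ge> 1"
    and "bij_betw ends UNIV (complete_edges n)"
  shows "f_vector (CRY ends n) =
    1 / fls_X + 1 / fls_X ^ n *
      (\<Sum>m = 0..n - 2. (- 1) ^ m * (1 + fls_X) ^ m * pi_poly (n - m) *
         complete_homogeneous m {1..n - m - 1} q_factor)"
proof -
  interpret complete_graph n ends using assms by unfold_locales
  \<comment> \<open>Initially the sink is the only possible head above \<open>n\<close>, hence the
    coefficient at 1; nothing is required, so only \<open>Z = {}\<close> remains.\<close>
  have "(\<Sum>E\<in>covering_graphs n {Suc n} {}. covering_weight n fls_X E) =
      transfer_coeff (fls_X :: rat fls) (n - 1) 1"
    using sum_covering_graphs[of "{Suc n}" "n - 1" "{}" "fls_X :: rat fls"] assms(1) by simp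
  then show ?thesis
    using transfer_coeff_1[OF assms(1), of "fls_X :: rat fls"]
    unfolding f_vector_CRY pi_poly_def q_factor_def by simp
qed

end
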